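(* Let $n,k\ge 1$ be natural numbers and let $X$ be a closed subspace of $\mathbb R^k$. Then any continuous fixed-point free map $f:X\to \exp_n(\mathbb R^k)$ is brightly colorable.
   Context: For a topological space $Z$, $2^Z$ is the space of all non-empty closed subsets of $Z$ with the Vietoris topology, whose basic open sets are $\langle U_1,\dots,U_p\rangle=\{A\in 2^Z: A\subset U_1\cup\dots\cup U_p \text{ and } A\cap U_i\neq\emptyset \text{ for all } i\}$ with $U_1,\dots,U_p$ open in $Z$. $\exp_n(Z)$ is the subspace $\{A\in 2^Z: |A|\le n\}$. For $X\subset Z$, a map $f:X\to 2^Z$ is fixed-point free if $x\notin f(x)$ for every $x\in X$. A closed subset $F$ of $X$ is a bright color of $f$ if $F\cap \mathrm{cl}_Z\big(\bigcup\{f(x):x\in F\}\big)=\emptyset$. The map $f$ is brightly colorable if $X$ can be covered by finitely many bright colors of $f$. *)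

theory Defs
  imports "HOL-Analysis.Analysis"
begin

definition hyperspace :: "'a topology \<Rightarrow> 'a set set" where
  "hyperspace Z = {A. closedin Z A \<and> A \<noteq> {}}"

definition vietoris_basic :: "'a topology \<Rightarrow> 'a set set \<Rightarrow> 'a set set" where
  "vietoris_basic Z \<U> = {A \<in> hyperspace Z. A \<subseteq> \<Union>\<U> \<and> (\<forall>U\<in>\<U>. A \<inter> U \<noteq> {})}"

definition vietoris_topology :: "'a topology \<Rightarrow> 'a set topology" where
  "vietoris_topology Z =
     topology_generated_by {vietoris_basic Z \<U> | \<U>. finite \<U> \<and> \<U> \<noteq> {} \<and> (\<forall>U\<in>\<U>. openin Z U)}"

text \<open>
  \<^const>\<open>topology_generated_by\<close> only asks for a subbase. The sets \<^const>\<open>vietoris_basic\<close> cover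
  the hyperspace and are closed under binary intersection, so they form a base of this topology.
\<close>

lemma topspace_vietoris_topology: "topspace (vietoris_topology Z) = hyperspace Z"
proof
  show "topspace (vietoris_topology Z) \<subseteq> hyperspace Z"
    unfolding vietoris_topology_def topology_generated_by_topspace vietoris_basic_def by blast
  have "vietoris_basic Z {topspace Z} = hyperspace Z"
    unfolding vietoris_basic_def hyperspace_def using closedin_subset by fastforce
  then have "openin (vietoris_topology Z) (hyperspace Z)"
    unfolding vietoris_topology_def
    by (intro topology_generated_by_Basis CollectI exI[of _ "{topspace Z}"]) simp
  then show "hyperspace Z \<subseteq> topspace (vietoris_topology Z)"
    by (rule openin_subset)
qed

lemma vietoris_basic_Int:
  "vietoris_basic Z \<U> \<inter> vietoris_basic Z \<V> =
         vietoris_basic Z ((\<lambda>U. U \<inter> \<Union>\<V>) ` \<U> \<union> (\<lambda>V. V \<inter> \<Union>\<U>) ` \<V>)"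
proof (rule set_eqI)
  fix A
  let ?W = "(\<lambda>U. U \<inter> \<Union>\<V>) ` \<U> \<union> (\<lambda>V. V \<inter> \<Union>\<U>) ` \<V>"
  have W: "\<Union>?W = \<Union>\<U> \<inter> \<Union>\<V>"
    by auto
  show "A \<in> vietoris_basic Z \<U> \<inter> vietoris_basic Z \<V> \<longleftrightarrow> A \<in> vietoris_basic Z ?W"
  proof (cases "A \<subseteq> \<Union>\<U> \<and> A \<subseteq> \<Union>\<V>")
    case True
    have "A \<inter> (U \<inter> B) = A \<inter> U" if "A \<subseteq> B" for U B
      using that by auto
    with True have "(\<forall>W\<in>?W. A \<inter> W \<noteq> {}) \<longleftrightarrow>
        (\<forall>U\<in>\<U>. A \<inter> U \<noteq> {}) \<and> (\<forall>V\<in>\<V>. A \<inter> V \<noteq> {})"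
      by (simp only: ball_Un ball_simps)
    with True W show ?thesis
      by (simp only: vietoris_basic_def Int_iff mem_Collect_eq Int_subset_iff) argo
  next
    case False
    with W show ?thesis
      by (simp only: vietoris_basic_def Int_iff mem_Collect_eq Int_subset_iff) argo
  qed
qed

definition exp_space :: "nat \<Rightarrow> 'a topology \<Rightarrow> 'a set topology" where
  "exp_space n Z = subtopology (vietoris_topology Z) {A. finite A \<and> card A \<le> n}"

definition fixed_point_free :: "'a set \<Rightarrow> ('a \<Rightarrow> 'a set) \<Rightarrow> bool" where
  "fixed_point_free X f \<longleftrightarrow> (\<forall>x\<in>X. x \<notin> f x)"

definition bright_color :: "'a topology \<Rightarrow> 'a set \<Rightarrow> ('a \<Rightarrow> 'a set) \<Rightarrow> 'a set \<Rightarrow> bool" where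
  "bright_color Z X f F \<longleftrightarrow>
     closedin (subtopology Z X) F \<and> F \<inter> Z closure_of (\<Union>x\<in>F. f x) = {}"

definition brightly_colorable :: "'a topology \<Rightarrow> 'a set \<Rightarrow> ('a \<Rightarrow> 'a set) \<Rightarrow> bool" where
  "brightly_colorable Z X f \<longleftrightarrow>
     (\<exists>\<F>. finite \<F> \<and> (\<forall>F\<in>\<F>. bright_color Z X f F) \<and> X \<subseteq> \<Union>\<F>)"

end

theory Submission
  imports Defs "HOL-Number_Theory.Number_Theory"
begin

text \<open>
  Only upper semicontinuity of \<open>f\<close> is used. A compact set \<open>K\<close> has some finite open cover whose
  members are bright; by refining with grid cubes its order is at most \<open>3\<^sup>k\<close>. The number of colors
  is then reduced to a constant depending only on \<open>n\<close> and \<open>k\<close>, as in Linial's distributed graph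
  coloring: a point \<open>x\<close> of color \<open>c\<close> knows the at most \<open>n 3\<^sup>k\<close> colors \<open>C\<close> met by \<open>f x\<close>, none of which
  is \<open>c\<close>, and takes as new color an element of \<open>S c\<close> outside all \<open>S i\<close> with \<open>i \<in> C\<close>, where \<open>S\<close> is
  a cover-free family of sets.

  For general \<open>X\<close>, cut it into concentric annuli so thick that \<open>f\<close> maps each of them inside the outer
  boundary of the next one. Among the annuli of even index (likewise odd), values of \<open>f\<close> then lie only
  in the same or in earlier annuli, so these are colored one after the other: each gets
  the bounded coloring of a compact set, paired with a second component that is chosen greedily
  among \<open>n 3\<^sup>k + 1\<close> values to avoid the colors of earlier annuli met by \<open>f x\<close>.
\<close>

lemma quotient_remainder_unique:
  fixes q x x' y y' :: nat
  assumes "x * q + y = x' * q + y'" "y < q" "y' < q"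
  shows "x = x' \<and> y = y'"
proof -
  have "x = (x * q + y) div q" using assms(2) by simp
  also have "\<dots> = x'" unfolding assms(1) using assms(3) by simp
  finally show ?thesis using assms(1) by simp
qed

section \<open>Cover-free families from lines of a finite affine plane\<close>

text \<open>
  The sets are lines of the affine plane over the field with \<open>q\<close> elements: all
  \<open>q\<^sup>2\<close> non-vertical ones and a single vertical one, which makes one line more than
  there are points. They are padded by singletons.
\<close>

lemma cover_free_family:
  fixes q N :: nat
  assumes q: "prime q" and N: "q\<^sup>2 \<le> N"
  obtains S :: "nat \<Rightarrow> nat set" where
    "\<And>c. c \<le> N \<Longrightarrow> S c \<subseteq> {..<N}"
    "\<And>c C. finite C \<Longrightarrow> card C < q \<Longrightarrow> c \<notin> C \<Longrightarrow> \<not> S c \<subseteq> (\<Union>i\<in>C. S i)"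
proof -
  have q0: "q > 0" using q prime_gt_0_nat by blast
  \<comment> \<open>The base-\<open>q\<close> digits of \<open>c < q\<^sup>2\<close> are the slope
    and the intercept of a line whose equation is \<open>g c\<close>.\<close>
  define g where "g c x = (c div q * x + c mod q) mod q" for c x
  \<comment> \<open>The point (x, y) has the code \<open>x * q + y\<close>, so \<open>{..<q}\<close>
    is the vertical line x = 0. The shift to \<open>c - 1\<close> fits the N + 1 sets with c \<le> N
    onto N points; for \<open>c > q\<^sup>2\<close> the point \<open>c - 1\<close> lies off all
    lines.\<close>
  define S where "S c = (if c < q\<^sup>2 then (\<lambda>x. x * q + g c x) ` {..<q}
      else if c = q\<^sup>2 then {..<q} else {c - 1})" for c
  have g: "g c x < q" for c x using q0 by (simp add: g_def)
  have pt: "x * q + y < q\<^sup>2" if "x < q" "y < q" for x y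
  proof -
    have "x * q + y < x * q + q" using that by simp
    also have "\<dots> = Suc x * q" by simp
    also have "\<dots> \<le> q * q" using that by (intro mult_right_mono) auto
    finally show ?thesis by (simp add: power2_eq_square)
  qed
  have vert: "x * q + y < q \<longleftrightarrow> x = 0" if "y < q" for x y
    using that by (cases x) auto
  have small: "S c \<subseteq> {..<q\<^sup>2}" if "c \<le> q\<^sup>2" for c
  proof (cases "c < q\<^sup>2")
    case True
    then show ?thesis using pt g by (auto simp: S_def)
  next
    case False
    then show ?thesis using that q0 by (simp add: S_def power2_eq_square)
  qed
  \<comment> \<open>Two common points have different abscissae x, y, and (a - a')(x - y) is
    divisible by q. As q is prime, the slopes agree, and then the intercepts.\<close>
  have meet: "\<exists>z. S c \<inter> S i \<subseteq> {z}" if "c \<noteq> i" "c < q\<^sup>2" "i < q\<^sup>2" for c i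
  proof (rule ccontr)
    assume "\<not> ?thesis"
    then obtain z w where zw: "z \<in> S c" "z \<in> S i" "w \<in> S c" "w \<in> S i" "z \<noteq> w"
      by blast
    from zw that g obtain x where x: "x < q" "z = x * q + g c x" "g c x = g i x"
      by (auto simp: S_def dest!: quotient_remainder_unique)
    from zw that g obtain y where y: "y < q" "w = y * q + g c y" "g c y = g i y"
      by (auto simp: S_def dest!: quotient_remainder_unique)
    have "x \<noteq> y" using x y zw by auto
    define a b a' b' where ab: "a = int (c div q)" "b = int (c mod q)"
      "a' = int (i div q)" "b' = int (i mod q)"
    have cg: "[a * int t + b = a' * int t + b'] (mod int q)" if "g c t = g i t" for t
      using that unfolding g_def ab cong_def by (metis of_nat_add of_nat_mult zmod_int)
    have "[(a * int x + b) - (a * int y + b) = (a' * int x + b') - (a' * int y + b')] (mod int q)"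
      using cg x y by (intro cong_diff) auto
    then have "int q dvd (a - a') * (int x - int y)"
      by (simp add: cong_iff_dvd_diff algebra_simps)
    moreover have "prime (int q)" using q by simp
    ultimately have dv: "int q dvd a - a' \<or> int q dvd int x - int y"
      by (meson prime_dvd_mult_iff)
    have eq: "t = t'" if "int q dvd int t - int t'" "t < q" "t' < q" for t t'
      using that by (auto simp: cong_iff_dvd_diff[symmetric] cong_int_iff
          intro: cong_less_modulus_unique_nat)
    have "int q dvd a - a'"
      using dv eq[OF _ x(1) y(1)] \<open>x \<noteq> y\<close> by blast
    moreover have "c div q < q" "i div q < q"
      using that by (auto simp: less_mult_imp_div_less power2_eq_square)
    ultimately have "a = a'"
      using eq ab by auto
    then have "[b = b'] (mod int q)"
      using cg[OF x(3)] by (simp add: cong_add_lcancel)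
    then have "b = b'"
      using eq ab q0 by (simp add: cong_iff_dvd_diff)
    with \<open>a = a'\<close> have "c = i"
      unfolding ab by (metis div_mult_mod_eq of_nat_eq_iff)
    with that show False by simp
  qed
  have meet1: "\<exists>z. S c \<inter> S i \<subseteq> {z}" if ci: "c \<noteq> i" "c \<le> q\<^sup>2" for c i
  proof -
    consider "c < q\<^sup>2" "i < q\<^sup>2" | "c = q\<^sup>2" "i < q\<^sup>2" | "i = q\<^sup>2" "c < q\<^sup>2" | "i > q\<^sup>2"
      using ci by linarith
    then show ?thesis
    proof cases
      case 1 then show ?thesis using meet ci by blast
    next
      case 2
      then show ?thesis using g vert by (intro exI[of _ "g i 0"]) (auto simp: S_def)
    next
      case 3
      then show ?thesis using g vert by (intro exI[of _ "g c 0"]) (auto simp: S_def)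
    next
      case 4
      then show ?thesis by (intro exI[of _ "i - 1"]) (auto simp: S_def)
    qed
  qed
  have card: "card (S c) = q" if "c \<le> q\<^sup>2" for c
  proof (cases "c < q\<^sup>2")
    case True
    then have "inj_on (\<lambda>x. x * q + g c x) {..<q}"
      using g by (auto intro!: inj_onI dest!: quotient_remainder_unique)
    with True show ?thesis by (simp add: S_def card_image)
  qed (use that in \<open>simp add: S_def\<close>)
  show thesis
  proof
    show "S c \<subseteq> {..<N}" if "c \<le> N" for c
    proof (cases "c \<le> q\<^sup>2")
      case True then show ?thesis using small N by fastforce
    next
      case False then show ?thesis using that by (auto simp: S_def)
    qed
  next
    fix c C assume C: "finite (C :: nat set)" "card C < q" "c \<notin> C"
    show "\<not> S c \<subseteq> (\<Union>i\<in>C. S i)"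
    proof (cases "c \<le> q\<^sup>2")
      case True
      \<comment> \<open>A line has \<open>q\<close> points, and each of the fewer than
        \<open>q\<close> other sets covers at most one of them.\<close>
      have le1: "card (S c \<inter> S i) \<le> 1" if i: "i \<in> C" for i
      proof -
        obtain z where "S c \<inter> S i \<subseteq> {z}" using meet1[of c i] True C(3) i by blast
        then show ?thesis using card_mono[of "{z}"] by simp
      qed
      show ?thesis
      proof
        assume "S c \<subseteq> (\<Union>i\<in>C. S i)"
        then have "S c = (\<Union>i\<in>C. S c \<inter> S i)" by blast
        then have "card (S c) \<le> (\<Sum>i\<in>C. card (S c \<inter> S i))"
          using card_UN_le[OF C(1)] by metis
        also have "\<dots> \<le> card C" using sum_mono[of C, OF le1] by simp
        finally show False using C card[OF True] by simp
      qed
    next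
      case False
      have "c - 1 \<notin> S i" if "i \<in> C" for i
      proof (cases "i \<le> q\<^sup>2")
        case True
        then show ?thesis using small[OF True] False by force
      next
        case i: False
        have "c \<noteq> i" using that C by blast
        then have "c - 1 \<noteq> i - 1" using i False by linarith
        then show ?thesis using i by (simp add: S_def)
      qed
      moreover have "c - 1 \<in> S c" using False by (simp add: S_def)
      ultimately show ?thesis by blast
    qed
  qed
qed

section \<open>Closed shrinkings of finite open covers\<close>

text \<open>Induction over the colors. Normality separates the part of \<open>Y\<close> that only
  \<open>G c\<close> covers from the complement of \<open>G c\<close>. The complement of
  \<open>V\<close> becomes the piece of color \<open>c\<close>, and the other sets still cover
  \<open>Y - U\<close>.\<close>

lemma shrink_finite_open_cover:
  fixes Y :: "'a::metric_space set"
  assumes "finite C" "closed Y" "\<And>c. c \<in> C \<Longrightarrow> open (G c)" "Y \<subseteq> (\<Union>c\<in>C. G c)"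
  shows "\<exists>F. (\<forall>c\<in>C. closed (F c) \<and> F c \<subseteq> G c) \<and> Y \<subseteq> (\<Union>c\<in>C. F c)"
  using assms
proof (induction C arbitrary: Y)
  case empty
  then show ?case by simp
next
  case (insert c C)
  have "closed (Y - (\<Union>c\<in>C. G c))" "closed (- G c)" "(Y - (\<Union>c\<in>C. G c)) \<inter> - G c = {}"
    using insert.prems by (auto intro!: closed_Diff open_UN)
  then obtain U V where UV: "open U" "open V" "Y - (\<Union>c\<in>C. G c) \<subseteq> U" "- G c \<subseteq> V" "U \<inter> V = {}"
    by (metis t4_space)
  have "\<exists>F. (\<forall>c\<in>C. closed (F c) \<and> F c \<subseteq> G c) \<and> Y - U \<subseteq> (\<Union>c\<in>C. F c)"
    using insert.prems UV by (intro insert.IH) auto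
  then obtain F where F: "\<forall>c\<in>C. closed (F c) \<and> F c \<subseteq> G c" "Y - U \<subseteq> (\<Union>c\<in>C. F c)"
    by blast
  have "- V \<subseteq> G c" "closed (- V)" "Y \<inter> U \<subseteq> - V"
    using UV by auto
  with F \<open>c \<notin> C\<close> show ?case
    by (intro exI[of _ "F(c := - V)"]) auto
qed


section \<open>Refinements of bounded order by grid cubes\<close>

text \<open>In dimension k there are 3^k of them; this cardinality is the bound on the order of the
  refined covers.\<close>

definition sign_vectors :: "'a::euclidean_space set" where
  "sign_vectors = {p. \<forall>b\<in>Basis. p \<bullet> b \<in> {-1, 0, 1}}"

lemma finite_coordinates_in:
  assumes "finite S"
  shows "finite {p::'a::euclidean_space. \<forall>b\<in>Basis. p \<bullet> b \<in> S}"
proof (rule finite_subset)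
  show "{p::'a. \<forall>b\<in>Basis. p \<bullet> b \<in> S} \<subseteq> (\<lambda>g. \<Sum>b\<in>Basis. g b *\<^sub>R b) ` (Basis \<rightarrow>\<^sub>E S)"
  proof
    fix p :: 'a assume p: "p \<in> {p. \<forall>b\<in>Basis. p \<bullet> b \<in> S}"
    have "(\<Sum>b\<in>Basis. restrict (\<lambda>b. p \<bullet> b) Basis b *\<^sub>R b) = (\<Sum>b\<in>Basis. (p \<bullet> b) *\<^sub>R b)"
      by (rule sum.cong) simp_all
    then have "p = (\<Sum>b\<in>Basis. restrict (\<lambda>b. p \<bullet> b) Basis b *\<^sub>R b)"
      by (simp only: euclidean_representation)
    moreover have "restrict (\<lambda>b. p \<bullet> b) Basis \<in> Basis \<rightarrow>\<^sub>E S"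
      using p by (simp add: PiE_iff)
    ultimately show "p \<in> (\<lambda>g. \<Sum>b\<in>Basis. g b *\<^sub>R b) ` (Basis \<rightarrow>\<^sub>E S)"
      by (rule image_eqI)
  qed
  show "finite ((\<lambda>g. \<Sum>b\<in>Basis. g b *\<^sub>R b) ` (Basis \<rightarrow>\<^sub>E S))"
    using assms by (intro finite_imageI finite_PiE) auto
qed

text \<open>An integer within distance 1 of a real t is the floor of t or one of its two neighbors,
  so subtracting the vector of floors lands in \<open>sign_vectors\<close>. After rescaling, these
  points are the possible centers of closed cubes through a given point.\<close>

lemma card_integer_points_near:
  fixes x :: "'a::euclidean_space"
  shows "finite {p. \<forall>b\<in>Basis. p \<bullet> b \<in> \<int> \<and> \<bar>x \<bullet> b - p \<bullet> b\<bar> \<le> 1}" (is "finite ?A")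
    and "card {p. \<forall>b\<in>Basis. p \<bullet> b \<in> \<int> \<and> \<bar>x \<bullet> b - p \<bullet> b\<bar> \<le> 1} \<le> card (sign_vectors :: 'a set)"
proof -
  have fin: "finite (sign_vectors :: 'a set)"
    unfolding sign_vectors_def by (rule finite_coordinates_in) simp
  define m :: 'a where "m = (\<Sum>b\<in>Basis. of_int \<lfloor>x \<bullet> b\<rfloor> *\<^sub>R b)"
  have m: "m \<bullet> b = of_int \<lfloor>x \<bullet> b\<rfloor>" if "b \<in> Basis" for b
    using that by (simp add: m_def)
  have "?A \<subseteq> (\<lambda>v. v + m) ` sign_vectors"
  proof
    fix p assume p: "p \<in> ?A"
    have "(p - m) \<bullet> b \<in> {-1, 0, 1}" if b: "b \<in> Basis" for b
    proof -
      obtain z where z: "p \<bullet> b = of_int z" using p b Ints_cases by blast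
      have "\<bar>x \<bullet> b - of_int z\<bar> \<le> 1" using p b z by force
      then have "z - \<lfloor>x \<bullet> b\<rfloor> \<in> {-1, 0, 1}" by (simp; linarith)
      moreover have "(p - m) \<bullet> b = of_int (z - \<lfloor>x \<bullet> b\<rfloor>)"
        using z m b by (simp add: inner_diff_left)
      ultimately show ?thesis by auto
    qed
    then show "p \<in> (\<lambda>v. v + m) ` sign_vectors"
      unfolding sign_vectors_def by (intro image_eqI[of _ _ "p - m"]) auto
  qed
  moreover note fin card_image_le[OF fin, of "\<lambda>v. v + m"]
  ultimately show "finite ?A" "card ?A \<le> card (sign_vectors :: 'a set)"
    by (meson card_mono finite_imageI finite_subset le_trans)+
qed

text \<open>By the Lebesgue number of the cover, each small closed grid cube that matters lies in a
  single \<open>W x\<close>, and it inherits the color \<open>h x\<close>. Merging cubes of equal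
  color cannot raise the order, so the number of color classes at a point is bounded independently
  of the number of colors.\<close>

lemma coloured_refinement:
  fixes K :: "'a::euclidean_space set" and h :: "'a \<Rightarrow> 'c"
  assumes K: "compact K" and W: "\<And>x. x \<in> K \<Longrightarrow> open (W x)" "\<And>x. x \<in> K \<Longrightarrow> x \<in> W x"
  obtains G where "\<And>c. open (G c)" "K \<subseteq> (\<Union>c\<in>h ` K. G c)"
    "\<And>c. closure (G c) \<subseteq> \<Union>{W x |x. x \<in> K \<and> h x = c}"
    "\<And>y. finite {c. y \<in> closure (G c)}"
    "\<And>y. card {c. y \<in> closure (G c)} \<le> card (sign_vectors :: 'a set)"
proof -
  obtain e where e: "e > 0" "\<And>x. x \<in> K \<Longrightarrow> \<exists>V\<in>W ` K. ball x e \<subseteq> V"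
    using Heine_Borel_lemma[OF K, of "W ` K"] W by blast
  \<comment> \<open>Points of one cube differ by at most \<open>2 * d\<close> in each coordinate,
    hence by at most \<open>2 * d * DIM('a)\<close> in norm; the summand 1 makes this strictly less
    than \<open>e\<close>.\<close>
  define d where "d = e / (2 * DIM('a) + 1)"
  have d: "d > 0" "2 * d * DIM('a) < e"
    using e(1) by (auto simp: d_def field_simps)
  \<comment> \<open>Mesh \<open>d\<close> but half-side \<open>d\<close>: the cubes overlap, so that
    already the open ones cover the space. The closed cubes \<open>R p\<close> control the
    closures.\<close>
  define Q where "Q p = box (d *\<^sub>R (p - One)) (d *\<^sub>R (p + One))" for p :: 'a
  define R where "R p = cbox (d *\<^sub>R (p - One)) (d *\<^sub>R (p + One))" for p :: 'a
  have Q: "y \<in> Q p \<longleftrightarrow> (\<forall>b\<in>Basis. d * (p \<bullet> b - 1) < y \<bullet> b \<and> y \<bullet> b < d * (p \<bullet> b + 1))" for y p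
    unfolding Q_def mem_box by (simp add: inner_diff_left inner_add_left)
  have R: "y \<in> R p \<longleftrightarrow> (\<forall>b\<in>Basis. d * (p \<bullet> b - 1) \<le> y \<bullet> b \<and> y \<bullet> b \<le> d * (p \<bullet> b + 1))" for y p
    unfolding R_def mem_box by (simp add: inner_diff_left inner_add_left)
  have QR: "Q p \<subseteq> R p" for p
    unfolding Q_def R_def by (rule box_subset_cbox)
  define P where "P = {p. (\<forall>b\<in>Basis. p \<bullet> b \<in> \<int>) \<and> Q p \<inter> K \<noteq> {}}"
  have near: "\<bar>(inverse d *\<^sub>R y) \<bullet> b - p \<bullet> b\<bar> \<le> 1" if "y \<in> R p" "b \<in> Basis" for y p b
  proof -
    have "d * (p \<bullet> b - 1) \<le> y \<bullet> b \<and> y \<bullet> b \<le> d * (p \<bullet> b + 1)"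
      using R that by blast
    with d(1) show ?thesis by (simp add: field_simps abs_le_iff)
  qed
  \<comment> \<open>Finiteness makes the union of the closed cubes of one color closed, so that it
    contains the closure of the color class.\<close>
  have finP: "finite P"
  proof -
    obtain B where B: "\<And>x. x \<in> K \<Longrightarrow> norm x \<le> B"
      using compact_imp_bounded[OF K] bounded_iff by blast
    define M where "M = \<lceil>inverse d * B\<rceil> + 1"
    have "P \<subseteq> {p. \<forall>b\<in>Basis. p \<bullet> b \<in> of_int ` {-M..M}}"
    proof clarify
      fix p b :: 'a assume p: "p \<in> P" and b: "b \<in> Basis"
      then have "p \<bullet> b \<in> \<int>" "Q p \<inter> K \<noteq> {}"
        unfolding P_def by auto
      then obtain y z where y: "y \<in> Q p" "y \<in> K" and z: "p \<bullet> b = of_int z"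
        by (metis Ints_cases disjoint_iff)
      have "\<bar>inverse d * (y \<bullet> b) - of_int z\<bar> \<le> 1"
        using near[OF subsetD[OF QR y(1)] b] z by simp
      moreover have "\<bar>inverse d * (y \<bullet> b)\<bar> \<le> inverse d * B"
      proof -
        have "\<bar>y \<bullet> b\<bar> \<le> B"
          using Basis_le_norm[OF b, of y] B[OF y(2)] by linarith
        then have "inverse d * \<bar>y \<bullet> b\<bar> \<le> inverse d * B"
          using d(1) by (intro mult_left_mono) auto
        with d(1) show ?thesis by (simp only: abs_mult abs_inverse abs_of_pos)
      qed
      ultimately have "\<bar>of_int z\<bar> \<le> inverse d * B + 1"
        by linarith
      moreover have "inverse d * B + 1 \<le> of_int M" unfolding M_def by linarith
      ultimately have "of_int z \<le> (of_int M :: real)" "of_int (- M) \<le> (of_int z :: real)"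
        unfolding of_int_minus by linarith+
      then have "z \<in> {-M..M}" by (simp only: of_int_le_iff atLeastAtMost_iff)
      then show "p \<bullet> b \<in> of_int ` {-M..M}" using z by blast
    qed
    then show ?thesis
      by (rule finite_subset) (intro finite_coordinates_in finite_imageI finite_atLeastAtMost_int)
  qed
  have "\<exists>x\<in>K. R p \<subseteq> W x" if p: "p \<in> P" for p
  proof -
    obtain y where y: "y \<in> Q p" "y \<in> K" using p P_def by blast
    have "R p \<subseteq> ball y e"
    proof
      fix w assume w: "w \<in> R p"
      have "\<bar>(w - y) \<bullet> b\<bar> \<le> 2 * d" if "b \<in> Basis" for b
      proof -
        have "d * (p \<bullet> b - 1) \<le> w \<bullet> b \<and> w \<bullet> b \<le> d * (p \<bullet> b + 1)"
          using w that unfolding R by blast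
        moreover have "d * (p \<bullet> b - 1) \<le> y \<bullet> b \<and> y \<bullet> b \<le> d * (p \<bullet> b + 1)"
          using subsetD[OF QR y(1)] that unfolding R by blast
        ultimately show ?thesis
          unfolding inner_diff_left right_diff_distrib distrib_left mult_1_right by linarith
      qed
      then have "norm (w - y) \<le> (\<Sum>b\<in>(Basis::'a set). 2 * d)"
        by (intro order_trans[OF norm_le_l1] sum_mono)
      also have "\<dots> < e" using d by (simp add: mult.commute)
      finally show "w \<in> ball y e" by (simp add: dist_norm norm_minus_commute)
    qed
    with e(2)[OF y(2)] show ?thesis by blast
  qed
  then obtain X where X: "\<And>p. p \<in> P \<Longrightarrow> X p \<in> K \<and> R p \<subseteq> W (X p)"
    by metis
  define G where "G c = (\<Union>p\<in>{p \<in> P. h (X p) = c}. Q p)" for c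
  have cl: "closure (G c) \<subseteq> (\<Union>p\<in>{p \<in> P. h (X p) = c}. R p)" for c
  proof (rule closure_minimal)
    show "closed (\<Union>p\<in>{p \<in> P. h (X p) = c}. R p)"
      using finP by (intro closed_UN) (auto simp: R_def)
  qed (use QR in \<open>auto simp: G_def\<close>)
  have ord: "{c. y \<in> closure (G c)} \<subseteq>
      (\<lambda>p. h (X p)) ` {p. \<forall>b\<in>Basis. p \<bullet> b \<in> \<int> \<and> \<bar>(inverse d *\<^sub>R y) \<bullet> b - p \<bullet> b\<bar> \<le> 1}" for y
  proof clarify
    fix c assume "y \<in> closure (G c)"
    then obtain p where p: "p \<in> P" "h (X p) = c" "y \<in> R p" using cl by blast
    have "p \<in> {p. \<forall>b\<in>Basis. p \<bullet> b \<in> \<int> \<and> \<bar>(inverse d *\<^sub>R y) \<bullet> b - p \<bullet> b\<bar> \<le> 1}"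
      using p(1) near[OF p(3)] unfolding P_def by blast
    with p(2) show "c \<in> (\<lambda>p. h (X p)) ` {p. \<forall>b\<in>Basis. p \<bullet> b \<in> \<int> \<and>
        \<bar>(inverse d *\<^sub>R y) \<bullet> b - p \<bullet> b\<bar> \<le> 1}"
      by blast
  qed
  show thesis
  proof
    show "open (G c)" for c
      unfolding G_def Q_def by (intro open_UN ballI open_box)
    show "K \<subseteq> (\<Union>c\<in>h ` K. G c)"
    proof
      fix y assume y: "y \<in> K"
      define p where "p = (\<Sum>b\<in>Basis. of_int \<lfloor>y \<bullet> b / d\<rfloor> *\<^sub>R b)"
      have p: "p \<bullet> b = of_int \<lfloor>y \<bullet> b / d\<rfloor>" if "b \<in> Basis" for b
        using that by (simp add: p_def)
      have "y \<in> Q p"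
        unfolding Q
      proof
        fix b :: 'a assume b: "b \<in> Basis"
        have "p \<bullet> b - 1 < y \<bullet> b / d" "y \<bullet> b / d < p \<bullet> b + 1"
          unfolding p[OF b] by linarith+
        then show "d * (p \<bullet> b - 1) < y \<bullet> b \<and> y \<bullet> b < d * (p \<bullet> b + 1)"
          using d(1) by (simp add: field_simps)
      qed
      moreover have "p \<in> P" using \<open>y \<in> Q p\<close> y p by (auto simp: P_def)
      ultimately have "y \<in> G (h (X p))" "h (X p) \<in> h ` K"
        using X[of p] unfolding G_def by auto
      then show "y \<in> (\<Union>c\<in>h ` K. G c)" by blast
    qed
    show "closure (G c) \<subseteq> \<Union>{W x |x. x \<in> K \<and> h x = c}" for c
    proof
      fix y assume "y \<in> closure (G c)"
      then obtain p where "p \<in> P" "h (X p) = c" "y \<in> R p" using cl by blast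
      with X[of p] show "y \<in> \<Union>{W x |x. x \<in> K \<and> h x = c}" by blast
    qed
    show "finite {c. y \<in> closure (G c)}" for y
      using ord card_integer_points_near(1) by (rule finite_subset[OF _ finite_imageI])
    show "card {c. y \<in> closure (G c)} \<le> card (sign_vectors :: 'a set)" for y
      by (rule order_trans[OF card_mono[OF finite_imageI[OF card_integer_points_near(1)] ord]
            order_trans[OF card_image_le[OF card_integer_points_near(1)] card_integer_points_near(2)]])
  qed
qed

section \<open>Bright covers of compact sets\<close>

text \<open>Upper semicontinuity is stated with neighborhoods open in the whole space, the form in
  which \<open>coloured_refinement\<close> takes them.\<close>

locale usc_multimap =
  fixes X :: "'a::euclidean_space set" and f :: "'a \<Rightarrow> 'a set" and n :: nat
  assumes finite_values: "x \<in> X \<Longrightarrow> finite (f x)"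
    and card_values: "x \<in> X \<Longrightarrow> card (f x) \<le> n"
    and no_fixed_point: "x \<in> X \<Longrightarrow> x \<notin> f x"
    and usc: "x \<in> X \<Longrightarrow> closed B \<Longrightarrow> f x \<inter> B = {} \<Longrightarrow>
      \<exists>W. open W \<and> x \<in> W \<and> (\<forall>x'\<in>X \<inter> W. f x' \<inter> B = {})"
begin

text \<open>The classes are open in the whole space and their order is bounded at every point,
  because values of \<open>f\<close> may lie outside \<open>K\<close>. Brightness for closures makes
  the set of colors met by \<open>f x\<close> upper semicontinuous.\<close>

definition bright_cover :: "'a set \<Rightarrow> 'c set \<Rightarrow> ('c \<Rightarrow> 'a set) \<Rightarrow> bool" where
  "bright_cover K C G \<longleftrightarrow> finite C \<and> (\<forall>c. open (G c)) \<and> (\<forall>c. c \<notin> C \<longrightarrow> G c = {}) \<and>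
     K \<subseteq> (\<Union>c\<in>C. G c) \<and> (\<forall>y. card {c \<in> C. y \<in> closure (G c)} \<le> card (sign_vectors :: 'a set)) \<and>
     (\<forall>c. \<forall>x\<in>K \<inter> closure (G c). f x \<inter> closure (G c) = {})"

lemma bright_coverD:
  assumes "bright_cover K C G"
  shows "finite C" "\<And>c. open (G c)" "\<And>c. c \<notin> C \<Longrightarrow> G c = {}" "K \<subseteq> (\<Union>c\<in>C. G c)"
    "\<And>y. card {c \<in> C. y \<in> closure (G c)} \<le> card (sign_vectors :: 'a set)"
    "\<And>c x. x \<in> K \<Longrightarrow> x \<in> closure (G c) \<Longrightarrow> f x \<inter> closure (G c) = {}"
  using assms unfolding bright_cover_def by auto

text \<open>The sets missed by \<open>f x\<close> have a closed union, to which upper semicontinuity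
  applies at once: near \<open>x\<close> no further set is met.\<close>

lemma usc_family:
  assumes "finite C" "\<And>c. closed (B c)" "x \<in> X"
  obtains W where "open W" "x \<in> W"
    "\<And>x'. x' \<in> X \<inter> W \<Longrightarrow> {c \<in> C. f x' \<inter> B c \<noteq> {}} \<subseteq> {c \<in> C. f x \<inter> B c \<noteq> {}}"
proof -
  let ?B = "\<Union>c\<in>{c \<in> C. f x \<inter> B c = {}}. B c"
  have "closed ?B" using assms(1,2) by (intro closed_UN) simp_all
  moreover have "f x \<inter> ?B = {}" by auto
  ultimately have "\<exists>W. open W \<and> x \<in> W \<and> (\<forall>x'\<in>X \<inter> W. f x' \<inter> ?B = {})"
    by (rule usc[OF assms(3)])
  then obtain W where W: "open W" "x \<in> W" "\<forall>x'\<in>X \<inter> W. f x' \<inter> ?B = {}"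
    by (elim exE conjE)
  have "{c \<in> C. f x' \<inter> B c \<noteq> {}} \<subseteq> {c \<in> C. f x \<inter> B c \<noteq> {}}" if x': "x' \<in> X \<inter> W" for x'
  proof clarify
    fix c assume c: "c \<in> C" "f x' \<inter> B c \<noteq> {}" "f x \<inter> B c = {}"
    then have "B c \<subseteq> ?B" by blast
    then have "f x' \<inter> B c \<subseteq> f x' \<inter> ?B" by (rule Int_mono[OF order_refl])
    with bspec[OF W(3) x'] have "f x' \<inter> B c = {}" by (simp only: subset_empty)
    with c(2) show False by (rule notE)
  qed
  with W(1,2) show thesis by (rule that)
qed

lemma card_hit:
  assumes "x \<in> X" "finite C" "\<And>y. card {c \<in> C. y \<in> B c} \<le> k"
  shows "card {c \<in> C. f x \<inter> B c \<noteq> {}} \<le> n * k"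
proof -
  have "{c \<in> C. f x \<inter> B c \<noteq> {}} = (\<Union>y\<in>f x. {c \<in> C. y \<in> B c})"
    by auto
  then have "card {c \<in> C. f x \<inter> B c \<noteq> {}} \<le> (\<Sum>y\<in>f x. card {c \<in> C. y \<in> B c})"
    using card_UN_le[OF finite_values[OF assms(1)], of "\<lambda>y. {c \<in> C. y \<in> B c}"] by simp
  also have "\<dots> \<le> card (f x) * k"
    using sum_bounded_above[of "f x" "\<lambda>y. card {c \<in> C. y \<in> B c}" k] assms(3) by simp
  also have "\<dots> \<le> n * k"
    using card_values[OF assms(1)] by simp
  finally show ?thesis .
qed

text \<open>Some closed ball around \<open>x\<close> misses the finite set \<open>f x\<close>, and
  by upper semicontinuity the values near \<open>x\<close> miss it too. Finitely many such
  neighborhoods cover \<open>K\<close>; their indices are the colors.\<close>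

lemma bright_cover_exists:
  assumes K: "compact K" "K \<subseteq> X"
  shows "\<exists>N G. bright_cover K {..<N::nat} G"
proof -
  have "\<exists>W. open W \<and> x \<in> W \<and> (\<forall>x'\<in>X \<inter> W. f x' \<inter> closure W = {})" if x: "x \<in> X" for x
  proof -
    have "open (- f x)" "x \<in> - f x"
      using finite_values[OF x] no_fixed_point[OF x] by (auto intro: finite_imp_closed)
    then obtain e where e: "e > 0" "cball x e \<subseteq> - f x"
      using open_contains_cball by blast
    then obtain W where W: "open W" "x \<in> W" "\<forall>x'\<in>X \<inter> W. f x' \<inter> cball x e = {}"
      using usc[OF x, of "cball x e"] by auto
    have "closure (W \<inter> ball x e) \<subseteq> cball x e"
      by (rule closure_minimal) auto
    then show ?thesis
      using W e(1) by (intro exI[of _ "W \<inter> ball x e"]) auto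
  qed
  then have "\<forall>x\<in>X. \<exists>W. open W \<and> x \<in> W \<and> (\<forall>x'\<in>X \<inter> W. f x' \<inter> closure W = {})"
    by (rule ballI)
  from bchoice[OF this] obtain W where
    "\<forall>x\<in>X. open (W x) \<and> x \<in> W x \<and> (\<forall>x'\<in>X \<inter> W x. f x' \<inter> closure (W x) = {})"
    by (rule exE)
  then have W: "\<And>x. x \<in> X \<Longrightarrow> open (W x)" "\<And>x. x \<in> X \<Longrightarrow> x \<in> W x"
    "\<And>x x'. x \<in> X \<Longrightarrow> x' \<in> X \<Longrightarrow> x' \<in> W x \<Longrightarrow> f x' \<inter> closure (W x) = {}"
    by auto
  obtain T where T: "T \<subseteq> K" "finite T" "K \<subseteq> (\<Union>t\<in>T. W t)"
  proof (rule compactE_image[OF K(1)])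
    show "open (W x)" if "x \<in> K" for x using W(1) K(2) that by blast
    show "K \<subseteq> (\<Union>x\<in>K. W x)" using W(2) K(2) by blast
  qed
  obtain h where h: "bij_betw h {..<card T} T"
    using ex_bij_betw_nat_finite[OF T(2)] unfolding lessThan_atLeast0 by blast
  have "\<exists>i<card T. x \<in> W (h i)" if x: "x \<in> K" for x
  proof -
    from x T(3) obtain t where "t \<in> T" "x \<in> W t" by blast
    with bij_betw_imp_surj_on[OF h] show ?thesis by (metis imageE lessThan_iff)
  qed
  then obtain i where i: "\<And>x. x \<in> K \<Longrightarrow> i x < card T" "\<And>x. x \<in> K \<Longrightarrow> x \<in> W (h (i x))"
    by metis
  have hX: "h j \<in> X" if "j < card T" for j
    using bij_betwE[OF h] that T(1) K(2) by auto
  have op: "open (W (h (i x)))" if "x \<in> K" for x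
    using W(1) hX i(1) that by blast
  obtain G where G: "\<And>c. open (G c)" "K \<subseteq> (\<Union>c\<in>i ` K. G c)"
    "\<And>c. closure (G c) \<subseteq> \<Union>{W (h (i x)) |x. x \<in> K \<and> i x = c}"
    "\<And>y. finite {c. y \<in> closure (G c)}"
    "\<And>y. card {c. y \<in> closure (G c)} \<le> card (sign_vectors :: 'a set)"
    using coloured_refinement[OF K(1) op i(2), of i] by blast
  \<comment> \<open>The neighborhood \<open>W (h (i x))\<close> depends only on the color
    \<open>i x\<close>, so the union in \<open>G(3)\<close> is part of a single
    neighborhood.\<close>
  have GW: "closure (G c) \<subseteq> W (h c)" for c
    using G(3)[of c] by auto
  have Gempty: "closure (G c) = {}" if "\<not> c < card T" for c
  proof -
    have "{W (h (i x)) |x. x \<in> K \<and> i x = c} = {}" using i(1) that by blast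
    with G(3)[of c] show ?thesis by simp
  qed
  have "bright_cover K {..<card T} G"
    unfolding bright_cover_def
  proof (intro conjI allI ballI impI)
    show "G c = {}" if "c \<notin> {..<card T}" for c
      using Gempty[of c] that by simp
    show "K \<subseteq> (\<Union>c\<in>{..<card T}. G c)"
      using G(2) i(1) by blast
    show "card {c \<in> {..<card T}. y \<in> closure (G c)} \<le> card (sign_vectors :: 'a set)" for y
      by (rule order_trans[OF card_mono[OF G(4)] G(5)]) blast
    show "f x \<inter> closure (G c) = {}" if x: "x \<in> K \<inter> closure (G c)" for c x
    proof -
      have "c < card T" by (rule ccontr) (use x Gempty[of c] in simp)
      then have "f x \<inter> closure (W (h c)) = {}"
        using x GW K(2) by (intro W(3) hX) auto
      then show ?thesis using GW[of c] closure_subset[of "W (h c)"] by blast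
    qed
  qed (use G(1) in auto)
  then show ?thesis by blast
qed

section \<open>Reducing the number of colors on a compact set\<close>

text \<open>The cover-free family has N + 1 sets on N points, so replacing an old color
  \<open>c\<close> by an element of \<open>S c\<close> saves one color.\<close>

lemma bright_cover_reduce:
  assumes K: "compact K" "K \<subseteq> X" and q: "prime q" "n * card (sign_vectors :: 'a set) < q" "q\<^sup>2 \<le> N"
    and G: "bright_cover K {..<Suc N} G"
  shows "\<exists>G. bright_cover K {..<N} G"
proof -
  obtain S :: "nat \<Rightarrow> nat set" where S: "\<And>c. c \<le> N \<Longrightarrow> S c \<subseteq> {..<N}"
    "\<And>c C. finite C \<Longrightarrow> card C < q \<Longrightarrow> c \<notin> C \<Longrightarrow> \<not> S c \<subseteq> (\<Union>i\<in>C. S i)"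
    using cover_free_family[OF q(1,3)] by metis
  \<comment> \<open>The old colors met by \<open>f x\<close>: fewer than \<open>q\<close> of them,
    and brightness keeps the color of \<open>x\<close> itself out, so \<open>S c\<close> is not
    covered by their sets.\<close>
  define D where "D x = {c \<in> {..<Suc N}. f x \<inter> closure (G c) \<noteq> {}}" for x
  have "\<exists>c s W. c \<le> N \<and> s \<in> S c \<and> (\<forall>i\<in>D x. s \<notin> S i) \<and> open W \<and> x \<in> W \<and> W \<subseteq> G c \<and>
      (\<forall>x'\<in>X \<inter> W. D x' \<subseteq> D x)" if x: "x \<in> K" for x
  proof -
    obtain c where c: "c \<le> N" "x \<in> G c"
      using bright_coverD(4)[OF G] x by (metis UN_E less_Suc_eq_le lessThan_iff subsetD)
    have "c \<notin> D x"
      using bright_coverD(6)[OF G x, of c] c(2) closure_subset[of "G c"] by (auto simp: D_def)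
    moreover have "card (D x) < q"
      using card_hit[OF subsetD[OF K(2) x] bright_coverD(1,5)[OF G]] q(2) by (simp add: D_def)
    ultimately obtain s where "s \<in> S c" "\<forall>i\<in>D x. s \<notin> S i"
      using S(2)[of "D x" c] unfolding D_def by fastforce
    moreover obtain W where "open W" "x \<in> W" "\<And>x'. x' \<in> X \<inter> W \<Longrightarrow> D x' \<subseteq> D x"
      unfolding D_def using usc_family[OF finite_lessThan closed_closure subsetD[OF K(2) x]] by blast
    ultimately show ?thesis
      using c bright_coverD(2)[OF G, of c]
      by (intro exI[of _ c] exI[of _ s] exI[of _ "W \<inter> G c"]) auto
  qed
  \<comment> \<open>The triple of old color, new color and neighborhood is packed into one
    \<open>t\<close>, to be chosen in a single step.\<close>
  then have "\<forall>x\<in>K. \<exists>t. fst t \<le> N \<and> fst (snd t) \<in> S (fst t) \<and> (\<forall>i\<in>D x. fst (snd t) \<notin> S i) \<and>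
      open (snd (snd t)) \<and> x \<in> snd (snd t) \<and> snd (snd t) \<subseteq> G (fst t) \<and>
      (\<forall>x'\<in>X \<inter> snd (snd t). D x' \<subseteq> D x)"
    by (simp add: split_paired_Ex)
  from bchoice[OF this] obtain t where t: "\<forall>x\<in>K. fst (t x) \<le> N \<and> fst (snd (t x)) \<in> S (fst (t x)) \<and>
      (\<forall>i\<in>D x. fst (snd (t x)) \<notin> S i) \<and> open (snd (snd (t x))) \<and> x \<in> snd (snd (t x)) \<and>
      snd (snd (t x)) \<subseteq> G (fst (t x)) \<and> (\<forall>x'\<in>X \<inter> snd (snd (t x)). D x' \<subseteq> D x)"
    by (rule exE)
  define c where "c x = fst (t x)" for x
  define s where "s x = fst (snd (t x))" for x
  define W where "W x = snd (snd (t x))" for x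
  note defs = c_def[symmetric] s_def[symmetric] W_def[symmetric]
  from t have c: "\<And>x. x \<in> K \<Longrightarrow> c x \<le> N"
    and s: "\<And>x. x \<in> K \<Longrightarrow> s x \<in> S (c x)" "\<And>x i. x \<in> K \<Longrightarrow> i \<in> D x \<Longrightarrow> s x \<notin> S i"
    and W: "\<And>x. x \<in> K \<Longrightarrow> open (W x)" "\<And>x. x \<in> K \<Longrightarrow> x \<in> W x" "\<And>x. x \<in> K \<Longrightarrow> W x \<subseteq> G (c x)"
      "\<And>x x'. x \<in> K \<Longrightarrow> x' \<in> X \<Longrightarrow> x' \<in> W x \<Longrightarrow> D x' \<subseteq> D x"
    unfolding defs by blast+
  obtain G' where G': "\<And>c. open (G' c)" "K \<subseteq> (\<Union>c\<in>s ` K. G' c)"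
    "\<And>c. closure (G' c) \<subseteq> \<Union>{W x |x. x \<in> K \<and> s x = c}"
    "\<And>y. finite {c. y \<in> closure (G' c)}"
    "\<And>y. card {c. y \<in> closure (G' c)} \<le> card (sign_vectors :: 'a set)"
    using coloured_refinement[OF K(1) W(1,2), of s] by blast
  have sN: "s x < N" if "x \<in> K" for x
    using s(1) c S(1) that by blast
  have "bright_cover K {..<N} G'"
    unfolding bright_cover_def
  proof (intro conjI allI ballI impI)
    show "G' j = {}" if "j \<notin> {..<N}" for j
    proof -
      have "{W x |x. x \<in> K \<and> s x = j} = {}" using sN that by blast
      with G'(3)[of j] show ?thesis by simp
    qed
    show "K \<subseteq> (\<Union>c\<in>{..<N}. G' c)"
      using G'(2) sN by blast
    show "card {c \<in> {..<N}. y \<in> closure (G' c)} \<le> card (sign_vectors :: 'a set)" for y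
      by (rule order_trans[OF card_mono[OF G'(4)] G'(5)]) blast
    show "f x \<inter> closure (G' j) = {}" if x: "x \<in> K \<inter> closure (G' j)" for j x
    \<comment> \<open>Suppose \<open>x\<close> and a value \<open>y\<close> share the new color
      \<open>j\<close>, inherited from \<open>u\<close> and \<open>v\<close>. The old color
      \<open>c v\<close> is met by \<open>f x\<close>, hence by \<open>f u\<close>, so
      \<open>s u\<close> avoids \<open>S (c v)\<close>; but \<open>s v\<close> lies in it.\<close>
    proof (rule ccontr)
      assume "\<not> ?thesis"
      then obtain y where y: "y \<in> f x" "y \<in> closure (G' j)" by blast
      obtain u where u: "u \<in> K" "s u = j" "x \<in> W u" using x G'(3)[of j] by blast
      obtain v where v: "v \<in> K" "s v = j" "y \<in> W v" using y G'(3)[of j] by blast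
      have "y \<in> closure (G (c v))" using v W(3)[of v] closure_subset by blast
      then have "c v \<in> D x" using y c[OF v(1)] by (auto simp: D_def)
      then have "c v \<in> D u" using W(4)[OF u(1) _ u(3)] x K(2) by blast
      then show False using s(2)[OF u(1)] s(1)[OF v(1)] u(2) v(2) by metis
    qed
  qed (use G'(1) in auto)
  then show ?thesis by blast
qed

lemma bright_cover_mono:
  assumes "bright_cover K C G" "C \<subseteq> C'" "finite C'"
  shows "bright_cover K C' G"
proof -
  note G = bright_coverD[OF assms(1)]
  have "c \<in> C" if "y \<in> closure (G c)" for y c
    using G(3)[of c] that by (cases "c \<in> C") auto
  then have "{c \<in> C'. y \<in> closure (G c)} = {c \<in> C. y \<in> closure (G c)}" for y
    using assms(2) by blast
  moreover have "K \<subseteq> (\<Union>c\<in>C'. G c)" using G(4) assms(2) by blast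
  ultimately show ?thesis
    unfolding bright_cover_def
  proof (intro conjI allI impI ballI)
    show "G c = {}" if "c \<notin> C'" for c
      using G(3) that assms(2) by blast
    show "f x \<inter> closure (G c) = {}" if "x \<in> K \<inter> closure (G c)" for c x
      using G(6) that by blast
  qed (use G(2,5) assms(3) in auto)
qed

text \<open>Colors are removed one at a time until \<open>q\<^sup>2\<close> are left. As
  \<open>q\<close> does not depend on \<open>K\<close>, infinitely many compact sets can share one
  finite palette.\<close>

lemma bright_cover_bounded:
  assumes K: "compact K" "K \<subseteq> X" and q: "prime q" "n * card (sign_vectors :: 'a set) < q"
  shows "\<exists>G. bright_cover K {..<q\<^sup>2} G"
proof -
  have "\<exists>G. bright_cover K {..<q\<^sup>2} G" if "bright_cover K {..<N::nat} G" for N G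
    using that
  proof (induction N arbitrary: G)
    case 0
    then show ?case using bright_cover_mono[OF 0] by auto
  next
    case (Suc N)
    show ?case
    proof (cases "q\<^sup>2 \<le> N")
      case True
      then show ?thesis using bright_cover_reduce[OF K q True Suc.prems] Suc.IH by blast
    next
      case False
      then show ?thesis using bright_cover_mono[OF Suc.prems, of "{..<q\<^sup>2}"] by auto
    qed
  qed
  with bright_cover_exists[OF K] show ?thesis by blast
qed

section \<open>Greedy coloring of a sequence of compact sets\<close>

text \<open>The new classes stay inside \<open>V\<close>, which the old classes and the values on
  \<open>Z\<close> avoid, so nothing on \<open>Z\<close> is disturbed. For \<open>x\<close> in
  \<open>K\<close>, the first color component guards against values in new classes, the second
  against values in old ones.\<close>

lemma bright_cover_extend:
  assumes H: "bright_cover Z ({..<M} \<times> {..n * card (sign_vectors :: 'a set)}) H"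
    and P: "bright_cover K {..<M::nat} P" and K: "compact K" "K \<subseteq> X"
    and V: "open V" "K \<subseteq> V" "Z \<inter> V = {}" "\<And>x. x \<in> Z \<Longrightarrow> f x \<inter> V = {}" "\<And>c. closure (H c) \<inter> V = {}"
  shows "\<exists>H'. bright_cover (Z \<union> K) ({..<M} \<times> {..n * card (sign_vectors :: 'a set)}) H' \<and>
    (\<forall>c. H c \<subseteq> H' c \<and> closure (H' c) \<subseteq> closure (H c) \<union> V)"
proof -
  define C where "C = {..<M} \<times> {..n * card (sign_vectors :: 'a set)}"
  define D where "D x = {c \<in> C. f x \<inter> closure (H c) \<noteq> {}}" for x
  have finC: "finite C" by (simp add: C_def)
  have "\<exists>c W. c \<in> C \<and> c \<notin> D x \<and> open W \<and> x \<in> W \<and> W \<subseteq> P (fst c) \<inter> V \<and> (\<forall>x'\<in>X \<inter> W. D x' \<subseteq> D x)"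
    if x: "x \<in> K" for x
  proof -
    obtain a where a: "a < M" "x \<in> P a"
      using bright_coverD(4)[OF P] x by blast
    have cD: "card (D x) \<le> n * card (sign_vectors :: 'a set)"
      unfolding D_def C_def
      by (rule card_hit[OF subsetD[OF K(2) x] bright_coverD(1,5)[OF H]])
    \<comment> \<open>Pigeonhole: counting 0, there is one more candidate \<open>e\<close> than
      \<open>D x\<close> can have elements.\<close>
    have "\<exists>e\<le>n * card (sign_vectors :: 'a set). (a, e) \<notin> D x"
    proof (rule ccontr)
      assume "\<not> ?thesis"
      then have "Pair a ` {..n * card (sign_vectors :: 'a set)} \<subseteq> D x" by auto
      moreover have "finite (D x)" using finC by (simp add: D_def)
      ultimately have "card (Pair a ` {..n * card (sign_vectors :: 'a set)}) \<le> card (D x)" by (intro card_mono)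
      then show False using cD by (simp add: card_image inj_on_def)
    qed
    then obtain e where e: "e \<le> n * card (sign_vectors :: 'a set)" "(a, e) \<notin> D x" by blast
    obtain W where "open W" "x \<in> W" "\<And>x'. x' \<in> X \<inter> W \<Longrightarrow> D x' \<subseteq> D x"
      unfolding D_def using usc_family[OF finC closed_closure subsetD[OF K(2) x]] by blast
    then show ?thesis
      using a e x V(1,2) bright_coverD(2)[OF P, of a]
      by (intro exI[of _ "(a, e)"] exI[of _ "W \<inter> P a \<inter> V"]) (auto simp: C_def)
  qed
  then have "\<forall>x\<in>K. \<exists>t. fst t \<in> C \<and> fst t \<notin> D x \<and> open (snd t) \<and> x \<in> snd t \<and>
      snd t \<subseteq> P (fst (fst t)) \<inter> V \<and> (\<forall>x'\<in>X \<inter> snd t. D x' \<subseteq> D x)"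
    by (simp add: split_paired_Ex)
  from bchoice[OF this] obtain t where t: "\<forall>x\<in>K. fst (t x) \<in> C \<and> fst (t x) \<notin> D x \<and>
      open (snd (t x)) \<and> x \<in> snd (t x) \<and> snd (t x) \<subseteq> P (fst (fst (t x))) \<inter> V \<and>
      (\<forall>x'\<in>X \<inter> snd (t x). D x' \<subseteq> D x)"
    by (rule exE)
  define c where "c x = fst (t x)" for x
  define W where "W x = snd (t x)" for x
  note defs = c_def[symmetric] W_def[symmetric]
  from t have c: "\<And>x. x \<in> K \<Longrightarrow> c x \<in> C" "\<And>x. x \<in> K \<Longrightarrow> c x \<notin> D x"
    and W: "\<And>x. x \<in> K \<Longrightarrow> open (W x)" "\<And>x. x \<in> K \<Longrightarrow> x \<in> W x"
      "\<And>x. x \<in> K \<Longrightarrow> W x \<subseteq> P (fst (c x)) \<inter> V"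
      "\<And>x x'. x \<in> K \<Longrightarrow> x' \<in> X \<Longrightarrow> x' \<in> W x \<Longrightarrow> D x' \<subseteq> D x"
    unfolding defs by blast+
  obtain G where G: "\<And>j. open (G j)" "K \<subseteq> (\<Union>j\<in>c ` K. G j)"
    "\<And>j. closure (G j) \<subseteq> \<Union>{W x |x. x \<in> K \<and> c x = j}"
    "\<And>y. finite {j. y \<in> closure (G j)}"
    "\<And>y. card {j. y \<in> closure (G j)} \<le> card (sign_vectors :: 'a set)"
    using coloured_refinement[OF K(1) W(1,2), of c] by blast
  have GV: "closure (G j) \<subseteq> V" for j
    using G(3)[of j] W(3) by blast
  have GP: "closure (G j) \<subseteq> P (fst j)" for j
    using G(3)[of j] W(3) by blast
  have Gempty: "G j = {}" if "j \<notin> C" for j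
  proof -
    have "{W x |x. x \<in> K \<and> c x = j} = {}" using c(1) that by blast
    with G(3)[of j] show ?thesis by simp
  qed
  have H': "finite C" "\<And>j. open (H j)" "\<And>j. j \<notin> C \<Longrightarrow> H j = {}" "Z \<subseteq> (\<Union>j\<in>C. H j)"
    "\<And>y. card {j \<in> C. y \<in> closure (H j)} \<le> card (sign_vectors :: 'a set)"
    "\<And>j x. x \<in> Z \<Longrightarrow> x \<in> closure (H j) \<Longrightarrow> f x \<inter> closure (H j) = {}"
    using bright_coverD[OF H] unfolding C_def by blast+
  have "bright_cover (Z \<union> K) C (\<lambda>j. H j \<union> G j)"
    unfolding bright_cover_def closure_Un
  proof (intro conjI allI ballI impI)
    show "H j \<union> G j = {}" if "j \<notin> C" for j
      using Gempty[OF that] H'(3)[OF that] by simp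
    show "Z \<union> K \<subseteq> (\<Union>j\<in>C. H j \<union> G j)"
      using G(2) c(1) H'(4) by blast
    \<comment> \<open>The orders do not add up: on \<open>V\<close> only new closures count, off
      \<open>V\<close> only old ones.\<close>
    show "card {j \<in> C. y \<in> closure (H j) \<union> closure (G j)} \<le> card (sign_vectors :: 'a set)" for y
    proof (cases "y \<in> V")
      case True
      then have "{j \<in> C. y \<in> closure (H j) \<union> closure (G j)} \<subseteq> {j. y \<in> closure (G j)}"
        using V(5) by blast
      then show ?thesis using card_mono[OF G(4)] G(5) order_trans by blast
    next
      case False
      then have "{j \<in> C. y \<in> closure (H j) \<union> closure (G j)} = {j \<in> C. y \<in> closure (H j)}"
        using GV by blast
      then show ?thesis using H'(5) by simp
    qed
    show "f x \<inter> (closure (H j) \<union> closure (G j)) = {}"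
      if "x \<in> (Z \<union> K) \<inter> (closure (H j) \<union> closure (G j))" for j x
    proof (cases "x \<in> Z")
      case True
      then have "x \<in> closure (H j)" using that GV[of j] V(3) by blast
      then show ?thesis using H'(6)[OF True] V(4)[OF True] GV[of j] by blast
    next
      case False
      then have x: "x \<in> K" "x \<in> closure (G j)" using that V(2,5) by blast+
      then obtain u where u: "u \<in> K" "c u = j" "x \<in> W u" using G(3)[of j] by blast
      have "j \<notin> D x"
        using W(4)[OF u(1) _ u(3)] x(1) K(2) c(2)[OF u(1)] u(2) by blast
      moreover have "j \<in> C" using c(1) u by blast
      ultimately have "f x \<inter> closure (H j) = {}" by (simp add: D_def)
      moreover have "f x \<inter> closure (P (fst j)) = {}"
        using bright_coverD(6)[OF P x(1), of "fst j"] x(2) GP[of j] closure_subset[of "P (fst j)"]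
        by blast
      ultimately show ?thesis using GP[of j] closure_subset[of "P (fst j)"] by blast
    qed
  qed (use G(1) H'(2) finC in auto)
  moreover have "closure (H j \<union> G j) \<subseteq> closure (H j) \<union> V" for j
    unfolding closure_Un using GV[of j] by blast
  ultimately show ?thesis unfolding C_def by blast
qed

text \<open>\<open>bright_cover_extend\<close> is iterated with a fixed palette. The color classes
  only grow, so their unions over all stages are open, and a conflict in a union would already show
  at a finite stage.\<close>

lemma sequence_open_cover:
  fixes K V :: "nat \<Rightarrow> 'a set"
  assumes K: "\<And>m. compact (K m)" "\<And>m. K m \<subseteq> X"
    and V: "\<And>m. open (V m)" "\<And>m. K m \<subseteq> V m" "\<And>i j. i < j \<Longrightarrow> V i \<inter> V j = {}"
    and out: "\<And>i j x. i < j \<Longrightarrow> x \<in> K i \<Longrightarrow> f x \<inter> V j = {}"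
  shows "\<exists>(C :: (nat \<times> nat) set) G. finite C \<and> (\<forall>c\<in>C. open (G c)) \<and>
    (\<Union>m. K m) \<subseteq> (\<Union>c\<in>C. G c) \<and> (\<forall>c\<in>C. \<forall>x\<in>(\<Union>m. K m) \<inter> G c. f x \<inter> G c = {})"
proof -
  obtain q :: nat where q: "prime q" "n * card (sign_vectors :: 'a set) < q"
    using bigger_prime by blast
  define C where "C = {..<q\<^sup>2} \<times> {..n * card (sign_vectors :: 'a set)}"
  define Y where "Y m = (\<Union>j<m. K j)" for m
  have Y_Suc: "Y (Suc m) = Y m \<union> K m" for m
    by (simp add: Y_def lessThan_Suc Un_commute)
  \<comment> \<open>Keeping the closures inside the earlier \<open>V j\<close> makes them disjoint
    from the next set \<open>V m\<close>.\<close>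
  define I where "I m H \<longleftrightarrow> bright_cover (Y m) C H \<and> (\<forall>c. closure (H c) \<subseteq> (\<Union>j<m. V j))" for m H
  have "\<exists>H. \<forall>m. I m (H m) \<and> (\<forall>c. H m c \<subseteq> H (Suc m) c)"
  proof (rule dependent_nat_choice)
    have "bright_cover (Y 0) C (\<lambda>_. {})"
      by (simp add: bright_cover_def C_def Y_def)
    then show "\<exists>H. I 0 H" by (auto simp: I_def)
  next
    fix H m assume H: "I m H"
    obtain P where P: "bright_cover (K m) {..<q\<^sup>2} P"
      using bright_cover_bounded[OF K q] by blast
    have disj: "(\<Union>j<m. V j) \<inter> V m = {}"
      using V(3) by blast
    have "\<exists>H'. bright_cover (Y m \<union> K m) ({..<q\<^sup>2} \<times> {..n * card (sign_vectors :: 'a set)}) H' \<and>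
        (\<forall>c. H c \<subseteq> H' c \<and> closure (H' c) \<subseteq> closure (H c) \<union> V m)"
    proof (rule bright_cover_extend[OF _ P K V(1,2)])
      show "bright_cover (Y m) ({..<q\<^sup>2} \<times> {..n * card (sign_vectors :: 'a set)}) H"
        using H by (simp add: I_def C_def)
      have "Y m \<subseteq> (\<Union>j<m. V j)"
        unfolding Y_def using V(2) by (intro UN_mono) auto
      then show "Y m \<inter> V m = {}" using disj by blast
      show "f x \<inter> V m = {}" if "x \<in> Y m" for x
        using that out[of _ m x] by (auto simp: Y_def)
      show "closure (H c) \<inter> V m = {}" for c
      proof -
        have "closure (H c) \<subseteq> (\<Union>j<m. V j)" using H unfolding I_def by blast
        then show ?thesis using disj by blast
      qed
    qed
    then obtain H' where H': "bright_cover (Y (Suc m)) C H'"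
      "\<And>c. H c \<subseteq> H' c" "\<And>c. closure (H' c) \<subseteq> closure (H c) \<union> V m"
      unfolding Y_Suc C_def by blast
    have "closure (H' c) \<subseteq> (\<Union>j<Suc m. V j)" for c
    proof -
      have "closure (H c) \<subseteq> (\<Union>j<m. V j)" using H unfolding I_def by blast
      then show ?thesis using H'(3)[of c] unfolding lessThan_Suc by blast
    qed
    with H'(1,2) show "\<exists>H'. I (Suc m) H' \<and> (\<forall>c. H c \<subseteq> H' c)"
      unfolding I_def by blast
  qed
  then obtain H where "\<forall>m. I m (H m) \<and> (\<forall>c. H m c \<subseteq> H (Suc m) c)"
    by (rule exE)
  then have H: "\<And>m. bright_cover (Y m) C (H m)" "\<And>m c. H m c \<subseteq> H (Suc m) c"
    unfolding I_def by iprover+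
  have mono: "H i c \<subseteq> H j c" if "i \<le> j" for i j c
    using lift_Suc_mono_le[of "\<lambda>m. H m c", OF H(2) that] .
  show ?thesis
  proof (intro exI[of _ C] exI[of _ "\<lambda>c. \<Union>m. H m c"] conjI ballI)
    show "finite C" by (simp add: C_def)
    show "open (\<Union>m. H m c)" for c
      using bright_coverD(2)[OF H(1)] by blast
    show "(\<Union>m. K m) \<subseteq> (\<Union>c\<in>C. \<Union>m. H m c)"
    proof
      fix x assume "x \<in> (\<Union>m. K m)"
      then obtain m where "x \<in> Y (Suc m)" unfolding Y_Suc by blast
      then obtain c where "c \<in> C" "x \<in> H (Suc m) c"
        using bright_coverD(4)[OF H(1)[of "Suc m"]] by blast
      then show "x \<in> (\<Union>c\<in>C. \<Union>m. H m c)" by blast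
    qed
    show "f x \<inter> (\<Union>m. H m c) = {}" if x: "x \<in> (\<Union>m. K m) \<inter> (\<Union>m. H m c)" for c x
    proof -
      obtain i j where ij: "x \<in> K i" "x \<in> H j c" using x by blast
      have "f x \<inter> H k c = {}" for k
      proof -
        \<comment> \<open>A stage late enough that \<open>K i\<close> is already covered and that
          class \<open>c\<close> contains both \<open>x\<close> and all of
          \<open>H k c\<close>.\<close>
        define l where "l = Suc (i + j + k)"
        have "x \<in> Y l" using ij(1) by (auto simp: Y_def l_def)
        moreover have "x \<in> closure (H l c)"
          using ij(2) mono[of j l c] closure_subset[of "H l c"] by (auto simp: l_def)
        ultimately have "f x \<inter> closure (H l c) = {}"
          by (rule bright_coverD(6)[OF H(1)])
        moreover have "H k c \<subseteq> closure (H l c)"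
          using mono[of k l c] closure_subset[of "H l c"] by (auto simp: l_def)
        ultimately show ?thesis by blast
      qed
      then show ?thesis by blast
    qed
  qed
qed

text \<open>The limit classes are open, so they are shrunk to closed pieces. The values on a piece
  \<open>F c\<close> avoid the open set \<open>G c\<close>, and so does the closure of their union,
  while \<open>F c\<close> lies inside \<open>G c\<close>.\<close>

lemma sequence_brightly_colorable:
  fixes K V :: "nat \<Rightarrow> 'a set"
  assumes K: "\<And>m. compact (K m)" "\<And>m. K m \<subseteq> X"
    and V: "\<And>m. open (V m)" "\<And>m. K m \<subseteq> V m" "\<And>i j. i < j \<Longrightarrow> V i \<inter> V j = {}"
    and out: "\<And>i j x. i < j \<Longrightarrow> x \<in> K i \<Longrightarrow> f x \<inter> V j = {}"
    and clo: "closed (\<Union>m. K m)"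
  shows "\<exists>\<F>. finite \<F> \<and> (\<forall>F\<in>\<F>. bright_color euclidean X f F) \<and> (\<Union>m. K m) \<subseteq> \<Union>\<F>"
proof -
  let ?Y = "\<Union>m. K m"
  have "\<exists>(C :: (nat \<times> nat) set) G. finite C \<and> (\<forall>c\<in>C. open (G c)) \<and>
      ?Y \<subseteq> (\<Union>c\<in>C. G c) \<and> (\<forall>c\<in>C. \<forall>x\<in>?Y \<inter> G c. f x \<inter> G c = {})"
  proof (rule sequence_open_cover[OF K V(1,2)])
    show "V i \<inter> V j = {}" if "i < j" for i j using V(3) that .
    show "f x \<inter> V j = {}" if "i < j" "x \<in> K i" for i j x using out that .
  qed
  then obtain C :: "(nat \<times> nat) set" and G where "finite C \<and> (\<forall>c\<in>C. open (G c)) \<and>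
      ?Y \<subseteq> (\<Union>c\<in>C. G c) \<and> (\<forall>c\<in>C. \<forall>x\<in>?Y \<inter> G c. f x \<inter> G c = {})"
    by (elim exE)
  then have G: "finite C" "\<And>c. c \<in> C \<Longrightarrow> open (G c)" "?Y \<subseteq> (\<Union>c\<in>C. G c)"
      "\<And>c x. c \<in> C \<Longrightarrow> x \<in> ?Y \<Longrightarrow> x \<in> G c \<Longrightarrow> f x \<inter> G c = {}"
    by blast+
  have "\<exists>F. (\<forall>c\<in>C. closed (F c) \<and> F c \<subseteq> G c) \<and> ?Y \<subseteq> (\<Union>c\<in>C. F c)"
    by (rule shrink_finite_open_cover[OF G(1) clo _ G(3)]) (rule G(2))
  then obtain F where F: "\<And>c. c \<in> C \<Longrightarrow> closed (F c)" "\<And>c. c \<in> C \<Longrightarrow> F c \<subseteq> G c"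
      "?Y \<subseteq> (\<Union>c\<in>C. F c)"
    by blast
  have "bright_color euclidean X f (F c \<inter> ?Y)" if c: "c \<in> C" for c
    unfolding bright_color_def
  proof
    show "closedin (top_of_set X) (F c \<inter> ?Y)"
      using F(1)[OF c] clo K(2) by (intro closed_subset closed_Int) auto
    have "(\<Union>x\<in>F c \<inter> ?Y. f x) \<subseteq> - G c"
      using G(4)[OF c] F(2)[OF c] by blast
    then have "closure (\<Union>x\<in>F c \<inter> ?Y. f x) \<subseteq> - G c"
      using G(2)[OF c] by (intro closure_minimal) auto
    with F(2)[OF c] show "(F c \<inter> ?Y) \<inter> euclidean closure_of (\<Union>x\<in>F c \<inter> ?Y. f x) = {}"
      unfolding euclidean_closure_of by blast
  qed
  with G(1) F(3) show ?thesis
    by (intro exI[of _ "(\<lambda>c. F c \<inter> ?Y) ` C"]) auto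
qed

section \<open>Decomposition of closed sets into annuli\<close>

text \<open>Upper semicontinuity against the complement of a ball around \<open>f x\<close> gives
  local boundedness; compactness makes it global.\<close>

lemma bounded_values:
  assumes K: "compact K" "K \<subseteq> X"
  shows "bounded (\<Union>x\<in>K. f x)"
proof -
  have "\<exists>W. open W \<and> x \<in> W \<and> bounded (\<Union>x'\<in>X \<inter> W. f x')" if x: "x \<in> X" for x
  proof -
    obtain R where R: "f x \<subseteq> ball 0 R"
      using bounded_subset_ballD[OF finite_imp_bounded[OF finite_values[OF x]]] by blast
    then have "f x \<inter> - ball 0 R = {}" by blast
    then obtain W where W: "open W" "x \<in> W" "\<forall>x'\<in>X \<inter> W. f x' \<inter> - ball 0 R = {}"
      using usc[OF x, of "- ball 0 R"] by auto
    then have "(\<Union>x'\<in>X \<inter> W. f x') \<subseteq> ball 0 R" by blast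
    with W show ?thesis by (meson bounded_ball bounded_subset)
  qed
  then have "\<forall>x\<in>X. \<exists>W. open W \<and> x \<in> W \<and> bounded (\<Union>x'\<in>X \<inter> W. f x')" by (rule ballI)
  from bchoice[OF this] obtain W where
    W: "\<forall>x\<in>X. open (W x) \<and> x \<in> W x \<and> bounded (\<Union>x'\<in>X \<inter> W x. f x')"
    by (rule exE)
  obtain T where T: "T \<subseteq> K" "finite T" "K \<subseteq> (\<Union>t\<in>T. W t)"
  proof (rule compactE_image[OF K(1)])
    show "open (W x)" if "x \<in> K" for x using W K(2) that by blast
    show "K \<subseteq> (\<Union>x\<in>K. W x)" using W K(2) by blast
  qed
  have "bounded (\<Union>t\<in>T. \<Union>x'\<in>X \<inter> W t. f x')"
    using T(1,2) W K(2) by (intro bounded_UN) auto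
  moreover have "(\<Union>x\<in>K. f x) \<subseteq> (\<Union>t\<in>T. \<Union>x'\<in>X \<inter> W t. f x')"
    using T(3) K(2) by blast
  ultimately show ?thesis by (rule bounded_subset)
qed

text \<open>The radii are chosen recursively, since \<open>f\<close> is bounded on the compact set
  of points of \<open>X\<close> with norm at most \<open>r m\<close>. The gap 3 and the margin 1
  leave room for widening the annuli by 1.\<close>

lemma escape_radii:
  assumes "closed X"
  obtains r :: "nat \<Rightarrow> real" where "r 0 = 0" "\<And>m. r m + 3 \<le> r (Suc m)"
    "\<And>m x. x \<in> X \<Longrightarrow> norm x \<le> r m \<Longrightarrow> f x \<subseteq> ball 0 (r (Suc m) - 1)"
proof -
  have "\<exists>r::nat \<Rightarrow> real. \<forall>m. (m = 0 \<longrightarrow> r m = 0) \<and>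
      (r m + 3 \<le> r (Suc m) \<and> (\<forall>x\<in>X. norm x \<le> r m \<longrightarrow> f x \<subseteq> ball 0 (r (Suc m) - 1)))"
  proof (rule dependent_nat_choice)
    fix s :: real and m :: nat
    have "bounded (\<Union>x\<in>X \<inter> cball 0 s. f x)"
      using assms by (intro bounded_values closed_Int_compact) auto
    then obtain R where "(\<Union>x\<in>X \<inter> cball 0 s. f x) \<subseteq> ball 0 R"
      using bounded_subset_ballD by blast
    moreover have "ball 0 R \<subseteq> ball (0::'a) (max R (s + 2))"
      by (rule subset_ball) simp
    ultimately have "f x \<subseteq> ball 0 (max R (s + 2))" if "x \<in> X" "norm x \<le> s" for x
      using that by fastforce
    then show "\<exists>t. (Suc m = 0 \<longrightarrow> t = 0) \<and>
        (s + 3 \<le> t \<and> (\<forall>x\<in>X. norm x \<le> s \<longrightarrow> f x \<subseteq> ball 0 (t - 1)))"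
      by (intro exI[of _ "max R (s + 2) + 1"]) auto
  qed simp
  then show thesis using that by blast
qed

lemma brightly_colorable_closed:
  assumes X: "closed X"
  shows "brightly_colorable euclidean X f"
proof -
  obtain r :: "nat \<Rightarrow> real" where r: "r 0 = 0" "\<And>m. r m + 3 \<le> r (Suc m)"
    "\<And>m x. x \<in> X \<Longrightarrow> norm x \<le> r m \<Longrightarrow> f x \<subseteq> ball 0 (r (Suc m) - 1)"
    using escape_radii[OF X] by blast
  have r_mono: "r i \<le> r j" if "i \<le> j" for i j
    using that by (rule lift_Suc_mono_le[of r, rotated]) (use r(2) in \<open>smt (verit)\<close>)
  have r_growth: "real m \<le> r m" for m
  proof (induction m)
    case (Suc m)
    then show ?case using r(2)[of m] by simp
  qed (simp add: r(1))
  define A where "A m = X \<inter> {x. r m \<le> norm x \<and> norm x \<le> r (Suc m)}" for m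
  \<comment> \<open>Consecutive closed annuli meet along a sphere, whereas the widened ones are
    disjoint once the indices differ by 2. Hence the split by parity.\<close>
  define U where "U m = {x::'a. r m - 1 < norm x \<and> norm x < r (Suc m) + 1}" for m
  have A: "compact (A m)" "A m \<subseteq> X" "A m \<subseteq> U m" for m
  proof -
    have "closed {x::'a. r m \<le> norm x}"
      by (intro closed_Collect_le continuous_intros)
    then have "compact ((X \<inter> {x. r m \<le> norm x}) \<inter> cball 0 (r (Suc m)))"
      using X by (intro closed_Int_compact closed_Int) auto
    moreover have "A m = (X \<inter> {x. r m \<le> norm x}) \<inter> cball 0 (r (Suc m))"
      by (auto simp: A_def)
    ultimately show "compact (A m)" by simp
  qed (auto simp: A_def U_def)
  have openU: "open (U m)" for m
    unfolding U_def by (intro open_Collect_conj open_Collect_less continuous_intros)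
  have U_disj: "U i \<inter> U j = {}" if "i + 2 \<le> j" for i j
  proof -
    have "r (Suc i) + 3 \<le> r j" using r(2)[of "Suc i"] r_mono[of "Suc (Suc i)" j] that by simp
    then show ?thesis by (auto simp: U_def)
  qed
  \<comment> \<open>Points of \<open>A i\<close> have norm at most \<open>r (Suc i)\<close>, so
    their values have norm below \<open>r (Suc (Suc i)) - 1\<close>, which is at most the inner
    radius of \<open>U j\<close>.\<close>
  have out: "f x \<inter> U j = {}" if "x \<in> A i" "i + 2 \<le> j" for i j x
  proof -
    have "f x \<subseteq> ball 0 (r (Suc (Suc i)) - 1)"
      using r(3)[of x "Suc i"] that(1) by (simp add: A_def)
    moreover have "r (Suc (Suc i)) \<le> r j" using that(2) by (intro r_mono) simp
    ultimately show ?thesis by (fastforce simp: U_def)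
  qed
  \<comment> \<open>The annuli are locally finite: since m \<le> \<open>r m\<close>, a unit ball
    around \<open>x\<close> meets only annuli of index at most \<open>norm x + 1\<close>.\<close>
  have clo: "closed (\<Union>m. A (2 * m + p))" for p
  proof -
    have "closedin euclidean (\<Union>(range (\<lambda>m. A (2 * m + p))))"
    proof (rule closedin_locally_finite_Union)
      show "closedin euclidean S" if "S \<in> range (\<lambda>m. A (2 * m + p))" for S
        using that A(1) compact_imp_closed by auto
      have fin: "finite {S \<in> range (\<lambda>m. A (2 * m + p)). S \<inter> ball x 1 \<noteq> {}}" for x
      proof (rule finite_subset)
        show "{S \<in> range (\<lambda>m. A (2 * m + p)). S \<inter> ball x 1 \<noteq> {}} \<subseteq> A ` {..nat \<lceil>norm x + 1\<rceil>}"
        proof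
          fix S assume "S \<in> {S \<in> range (\<lambda>m. A (2 * m + p)). S \<inter> ball x 1 \<noteq> {}}"
          then obtain m y where S: "S = A (2 * m + p)" and y: "y \<in> A (2 * m + p)" "y \<in> ball x 1"
            by blast
          have "norm y \<le> norm x + 1"
            using y(2) norm_triangle_ineq2[of y x] by (simp add: dist_norm norm_minus_commute)
          moreover have "r (2 * m + p) \<le> norm y" using y(1) by (simp add: A_def)
          ultimately have "real (2 * m + p) \<le> norm x + 1"
            using r_growth[of "2 * m + p"] by linarith
          then have "2 * m + p \<le> nat \<lceil>norm x + 1\<rceil>" by linarith
          then show "S \<in> A ` {..nat \<lceil>norm x + 1\<rceil>}" unfolding S by blast
        qed
      qed simp
      show "locally_finite_in euclidean (range (\<lambda>m. A (2 * m + p)))"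
        unfolding locally_finite_in_def
      proof (intro conjI ballI)
        fix x :: 'a
        show "\<exists>B. openin euclidean B \<and> x \<in> B \<and> finite {S \<in> range (\<lambda>m. A (2 * m + p)). S \<inter> B \<noteq> {}}"
          using fin[of x] by (intro exI[of _ "ball x 1"] conjI) auto
      qed simp
    qed
    then show ?thesis by simp
  qed
  have "\<exists>\<F>. finite \<F> \<and> (\<forall>F\<in>\<F>. bright_color euclidean X f F) \<and> (\<Union>m. A (2 * m + p)) \<subseteq> \<Union>\<F>" for p
  proof (rule sequence_brightly_colorable[where V = "\<lambda>m. U (2 * m + p)"])
    show "U (2 * i + p) \<inter> U (2 * j + p) = {}" if "i < j" for i j
      using that by (intro U_disj) simp
    show "f x \<inter> U (2 * j + p) = {}" if "i < j" "x \<in> A (2 * i + p)" for i j x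
      using that by (intro out[of x "2 * i + p"]) simp_all
  qed (use A openU clo in auto)
  then obtain \<F> where \<F>: "\<And>p::nat. finite (\<F> p)" "\<And>p F. F \<in> \<F> p \<Longrightarrow> bright_color euclidean X f F"
    "\<And>p. (\<Union>m. A (2 * m + p)) \<subseteq> \<Union>(\<F> p)"
    by metis
  have "X \<subseteq> \<Union>(\<F> 0) \<union> \<Union>(\<F> 1)"
  proof
    fix x assume x: "x \<in> X"
    obtain k :: nat where "norm x \<le> real k" using real_arch_simple by blast
    then have ex: "\<exists>m. norm x \<le> r (Suc m)"
      using r_growth[of "Suc k"] by (intro exI[of _ k]) simp
    \<comment> \<open>Minimality gives the lower bound \<open>r m \<le> norm x\<close>; for
      \<open>m = 0\<close> it comes from \<open>r 0 = 0\<close>.\<close>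
    define m where "m = (LEAST m. norm x \<le> r (Suc m))"
    have "norm x \<le> r (Suc m)" unfolding m_def using ex by (rule LeastI_ex)
    moreover have "r m \<le> norm x"
    proof (cases m)
      case (Suc j)
      then have "\<not> norm x \<le> r (Suc j)"
        using not_less_Least[of j "\<lambda>m. norm x \<le> r (Suc m)"] unfolding m_def[symmetric] by simp
      with Suc show ?thesis by simp
    qed (simp add: r(1))
    ultimately have xA: "x \<in> A m" using x by (simp add: A_def)
    have "m = 2 * (m div 2) + 0 \<or> m = 2 * (m div 2) + 1" by linarith
    with xA have "x \<in> (\<Union>m. A (2 * m + 0)) \<or> x \<in> (\<Union>m. A (2 * m + 1))"
      by (metis UN_I UNIV_I)
    then show "x \<in> \<Union>(\<F> 0) \<union> \<Union>(\<F> 1)" using \<F>(3)[of 0] \<F>(3)[of 1] by blast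
  qed
  with \<F>(1,2) show ?thesis
    unfolding brightly_colorable_def by (intro exI[of _ "\<F> 0 \<union> \<F> 1"]) auto
qed

end

section \<open>From Vietoris continuity to upper semicontinuity\<close>

text \<open>A non-empty closed set misses the closed set \<open>B\<close> exactly when it lies in
  the basic Vietoris set given by the single open set \<open>- B\<close>, so the points whose values
  miss \<open>B\<close> form an open preimage.\<close>

lemma usc_multimap_exp_space:
  fixes X :: "'a::euclidean_space set"
  assumes f: "continuous_map (top_of_set X) (exp_space n euclidean) f"
    and fpf: "fixed_point_free X f"
  shows "usc_multimap X f n"
proof
  have fx: "f x \<in> hyperspace euclidean \<and> finite (f x) \<and> card (f x) \<le> n" if "x \<in> X" for x
    using continuous_map_funspace[OF f] that
    by (auto simp: exp_space_def topspace_vietoris_topology Pi_iff)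
  show "finite (f x)" "card (f x) \<le> n" if "x \<in> X" for x
    using fx[OF that] by auto
  show "x \<notin> f x" if "x \<in> X" for x
    using fpf that by (simp add: fixed_point_free_def)
  show "\<exists>W. open W \<and> x \<in> W \<and> (\<forall>x'\<in>X \<inter> W. f x' \<inter> B = {})"
    if x: "x \<in> X" and B: "closed B" "f x \<inter> B = {}" for x B
  proof -
    let ?O = "vietoris_basic euclidean {- B} \<inter> {A. finite A \<and> card A \<le> n}"
    have "openin (vietoris_topology euclidean) (vietoris_basic euclidean {- B})"
      unfolding vietoris_topology_def using B(1)
      by (intro topology_generated_by_Basis CollectI exI[of _ "{- B}"]) auto
    then have "openin (exp_space n euclidean) ?O"
      unfolding exp_space_def openin_subtopology by blast
    then have "openin (top_of_set X) {x \<in> topspace (top_of_set X). f x \<in> ?O}"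
      by (rule openin_continuous_map_preimage[OF f])
    then obtain W where W: "open W" "{x \<in> X. f x \<in> ?O} = X \<inter> W"
      by (auto simp: openin_open)
    have "f x \<in> ?O"
      using fx[OF x] B(2) by (auto simp: vietoris_basic_def hyperspace_def)
    then have "x \<in> W" using W(2) x by blast
    moreover have "f x' \<inter> B = {}" if "x' \<in> X \<inter> W" for x'
      using W(2) that by (auto simp: vietoris_basic_def)
    ultimately show ?thesis using W(1) by blast
  qed
qed

theorem theorem2p8:
  fixes n :: nat
    and X :: "(real ^ 'k) set"
    and f :: "real ^ 'k \<Rightarrow> (real ^ 'k) set"
  assumes "n \<ge> 1"
    and "closed X"
    and "continuous_map (subtopology euclidean X) (exp_space n euclidean) f"
    and "fixed_point_free X f"
  shows "brightly_colorable euclidean X f"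
  using usc_multimap.brightly_colorable_closed[OF usc_multimap_exp_space[OF assms(3,4)] assms(2)] .

end
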